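(* Let $J\in\Lambda^{p+1}(U,V)$ be a given interior current and let $\Phi\in\Lambda^{p}(U,V)$ be a field extended from a boundary field $\alpha\in\Lambda^p(B,V)$, i.e. $j^*\Phi=\alpha$. Then the connection $A\in\Lambda^1(U,\mathrm{End}(V))$ for which $d^{\nabla}\Phi=J$ is determined, in general non-uniquely, by the algebraic relation $$A\wedge\Phi=J-d\Phi .$$
   Context: $U\subset\mathbb{R}^n$, $0<n<\infty$, is an open star-shaped set with center $x_0$; $V$ is a finite-dimensional vector space; $\Lambda^p(U,V)=\Lambda^p(U)\otimes V$ denotes $V$-valued differential $p$-forms. $B\subset U$ is a regular convex closed (hyper)surface (a two-point set if $n=1$), and $j:B\hookrightarrow U$ is the inclusion. For a connection one-form $A\in\Lambda^1(U,\mathrm{End}(V))$, the covariant exterior derivative is $d^\nabla=d+A\wedge\_:\Lambda^p(U,V)\to\Lambda^{p+1}(U,V)$. A connection $A$ is sought (gauge field tomography) such that the given extended field $\Phi$ satisfies the parallel transport equation $d^\nabla\Phi=J$ with the given $J$. *)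

theory Defs
  imports "HOL-Analysis.Analysis" "HOL-Library.Function_Algebras"
begin

primrec Ck_on :: "nat \<Rightarrow> 'a::euclidean_space set \<Rightarrow> ('a \<Rightarrow> 'b::real_normed_vector) \<Rightarrow> bool" where
  "Ck_on 0 S f \<longleftrightarrow> continuous_on S f"
| "Ck_on (Suc k) S f \<longleftrightarrow>
     (\<forall>x\<in>S. f differentiable (at x)) \<and> (\<forall>h. Ck_on k S (\<lambda>x. frechet_derivative f (at x) h))"

text \<open>Derivatives are taken in the ambient space, so this is meant for open \<open>S\<close> only.\<close>

definition smooth_on :: "'a::euclidean_space set \<Rightarrow> ('a \<Rightarrow> 'b::real_normed_vector) \<Rightarrow> bool" where
  "smooth_on S f \<longleftrightarrow> (\<forall>k. Ck_on k S f)"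

text \<open>A tuple of \<open>p\<close> vectors is a sequence of which only the entries with index below \<open>p\<close> matter;
  the first clause makes equality of functions the right notion of equality of \<open>p\<close>-linear maps.\<close>

definition alternating :: "nat \<Rightarrow> ((nat \<Rightarrow> 'a::real_vector) \<Rightarrow> 'b::real_vector) \<Rightarrow> bool" where
  "alternating p f \<longleftrightarrow>
     (\<forall>v w. (\<forall>i<p. v i = w i) \<longrightarrow> f v = f w) \<and>
     (\<forall>v. \<forall>i<p. linear (\<lambda>a. f (v(i := a)))) \<and>
     (\<forall>v. \<forall>i<p. \<forall>j<p. i \<noteq> j \<and> v i = v j \<longrightarrow> f v = 0)"

type_synonym ('a, 'b) form = "'a \<Rightarrow> (nat \<Rightarrow> 'a) \<Rightarrow> 'b"

text \<open>Smooth \<open>p\<close>-forms on an open set \<open>U\<close> with values in a normed space. They are extended by zero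
  outside \<open>U\<close>, so that forms on \<open>U\<close> are equal iff they are equal as functions.\<close>

definition forms :: "'a::euclidean_space set \<Rightarrow> nat \<Rightarrow> ('a, 'b::real_normed_vector) form set" where
  "forms U p = {\<omega>. (\<forall>x\<in>U. alternating p (\<omega> x)) \<and> (\<forall>v. smooth_on U (\<lambda>x. \<omega> x v)) \<and>
                   (\<forall>x. x \<notin> U \<longrightarrow> \<omega> x = 0)}"

definition omit :: "nat \<Rightarrow> (nat \<Rightarrow> 'a) \<Rightarrow> nat \<Rightarrow> 'a" where
  "omit i v = (\<lambda>k. v (if k < i then k else Suc k))"

text \<open>The invariant formula for \<open>d\<close>, evaluated on constant vector fields (whose brackets vanish).\<close>

definition ext_deriv ::
    "'a::euclidean_space set \<Rightarrow> nat \<Rightarrow> ('a, 'b::real_normed_vector) form \<Rightarrow> ('a, 'b) form" where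
  "ext_deriv U p \<omega> = (\<lambda>x v. if x \<in> U
     then \<Sum>i\<le>p. (-1) ^ i *\<^sub>R frechet_derivative (\<lambda>y. \<omega> y (omit i v)) (at x) (v i)
     else 0)"

text \<open>The wedge product of an \<open>End(V)\<close>-valued one-form with a \<open>V\<close>-valued \<open>p\<close>-form, as the sum over
  \<open>(1,p)\<close>-shuffles, combined with the evaluation \<open>End(V) \<times> V \<rightarrow> V\<close>. For finite-dimensional \<open>V\<close> the
  type of bounded linear maps is all of \<open>End(V)\<close>.\<close>

definition wedge1 :: "nat \<Rightarrow> ('a, 'v \<Rightarrow>\<^sub>L 'v) form \<Rightarrow> ('a, 'v::real_normed_vector) form \<Rightarrow> ('a, 'v) form" where
  "wedge1 p A \<Phi> = (\<lambda>x v. \<Sum>i\<le>p. (-1) ^ i *\<^sub>R blinfun_apply (A x (\<lambda>_. v i)) (\<Phi> x (omit i v)))"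

definition cov_deriv ::
    "'a::euclidean_space set \<Rightarrow> nat \<Rightarrow> ('a, 'v \<Rightarrow>\<^sub>L 'v) form \<Rightarrow>
     ('a, 'v::real_normed_vector) form \<Rightarrow> ('a, 'v) form" where
  "cov_deriv U p A \<Phi> = ext_deriv U p \<Phi> + wedge1 p A \<Phi>"

text \<open>Boundaries of convex bodies that are smooth embedded hypersurfaces. On the real line these are
  exactly the two-point sets.\<close>

definition regular_convex_hypersurface :: "'a::euclidean_space set \<Rightarrow> bool" where
  "regular_convex_hypersurface B \<longleftrightarrow>
     (\<exists>K. convex K \<and> compact K \<and> interior K \<noteq> {} \<and> B = frontier K) \<and>
     (\<forall>x\<in>B. \<exists>W (g :: 'a \<Rightarrow> real). open W \<and> x \<in> W \<and> smooth_on W g \<and> B \<inter> W = {y\<in>W. g y = 0} \<and>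
        (\<forall>y\<in>W. \<exists>h. frechet_derivative g (at y) h \<noteq> 0))"

definition tangent_space :: "'a::euclidean_space set \<Rightarrow> 'a \<Rightarrow> 'a set" where
  "tangent_space B x = {v. \<exists>e>0. \<exists>c :: real \<Rightarrow> 'a. smooth_on {-e<..<e} c \<and>
     (\<forall>t\<in>{-e<..<e}. c t \<in> B) \<and> c 0 = x \<and> (c has_vector_derivative v) (at 0)}"

text \<open>The pullback along the inclusion of \<open>B\<close>: restriction to points of \<open>B\<close> and to vectors tangent
  to \<open>B\<close>, set to zero elsewhere so that equality of forms on \<open>B\<close> is equality of functions.\<close>

definition pullback_incl ::
    "'a::euclidean_space set \<Rightarrow> nat \<Rightarrow> ('a, 'b::real_normed_vector) form \<Rightarrow> ('a, 'b) form" where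
  "pullback_incl B p \<omega> =
     (\<lambda>x v. if x \<in> B \<and> (\<forall>i<p. v i \<in> tangent_space B x) then \<omega> x v else 0)"

text \<open>Smooth \<open>p\<close>-forms on an embedded submanifold \<open>B\<close>: those which near every point of \<open>B\<close> are
  induced by a smooth form on an open subset of the ambient space. Alternation and multilinearity on
  the tangent spaces are inherited from the ambient form.\<close>

definition forms_on_submanifold ::
    "'a::euclidean_space set \<Rightarrow> nat \<Rightarrow> ('a, 'b::real_normed_vector) form set" where
  "forms_on_submanifold B p = {\<alpha>.
     (\<forall>x\<in>B. \<exists>W. \<exists>\<omega>\<in>forms W p. open W \<and> x \<in> W \<and> (\<forall>y\<in>B \<inter> W. \<alpha> y = pullback_incl B p \<omega> y)) \<and>
     (\<forall>x. x \<notin> B \<longrightarrow> \<alpha> x = 0)}"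

end

theory Submission
  imports Defs "Jordan_Normal_Form.Determinant"
begin

no_notation scalar_prod (infix "\<bullet>" 70)

text \<open>The algebraic relation is the equation \<open>d\<Phi> + A \<and> \<Phi> = J\<close> with \<open>d\<Phi>\<close> moved to the other side.
  For non-uniqueness take \<open>J = 0\<close> and constant coefficients, so that \<open>d\<Phi> = 0\<close> and \<open>A = 0\<close> is a
  solution. If \<open>p \<ge> 1\<close> and \<open>\<Phi> = (dx\<^sub>1 \<and> \<dots> \<and> dx\<^sub>p) \<otimes> e\<close>, then \<open>A' = dx\<^sub>1 \<otimes> id\<close> is another solution
  since \<open>dx\<^sub>1 \<and> dx\<^sub>1 = 0\<close>; if \<open>p = 0\<close> and \<open>\<Phi> = e\<close>, then \<open>A' = dx\<^sub>1 \<otimes> T\<close> is one for every \<open>T\<close> that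
  annihilates \<open>e\<close>.\<close>

text \<open>Every derivative of \<open>f\<close> is constantly 0 on \<open>U\<close>, so the
  induction generalizes over \<open>f\<close> and \<open>c\<close>. Values off \<open>U\<close> do
  not matter because \<open>U\<close> is open; this is what permits the cutoff in
  \<open>const_form\<close>.\<close>

lemma Ck_on_const:
  assumes "open U" and "\<And>x. x \<in> U \<Longrightarrow> f x = c"
  shows "Ck_on k U f"
  using assms(2)
proof (induction k arbitrary: f c)
  case 0
  then show ?case
    by (simp add: continuous_on_eq[OF continuous_on_const])
next
  case (Suc k)
  have der: "(f has_derivative (\<lambda>h. 0)) (at x)" if "x \<in> U" for x
    by (rule has_derivative_transform_within_open[OF _ assms(1) that])
      (use Suc.prems in auto)
  then have "frechet_derivative f (at x) h = 0" if "x \<in> U" for x h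
    using frechet_derivative_at[OF der[OF that]] by metis
  then show ?case
    using der Suc.IH[of _ 0] by (auto simp: differentiable_def)
qed

definition const_form :: "'a set \<Rightarrow> ((nat \<Rightarrow> 'a) \<Rightarrow> 'b) \<Rightarrow> ('a, 'b::zero) form" where
  "const_form U f = (\<lambda>x v. if x \<in> U then f v else 0)"

lemma const_form_in_forms:
  assumes "open U" and "alternating p f"
  shows "const_form U f \<in> forms U p"
  using assms
  by (auto simp: forms_def const_form_def smooth_on_def fun_eq_iff intro!: Ck_on_const)

lemma ext_deriv_const_form:
  assumes "open U"
  shows "ext_deriv U p (const_form U f) = 0"
proof -
  have "frechet_derivative (\<lambda>y. const_form U f y w) (at x) = (\<lambda>h. 0)" if "x \<in> U" for x w
    by (rule frechet_derivative_at[symmetric],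
        rule has_derivative_transform_within_open[OF has_derivative_const assms that])
      (simp add: const_form_def)
  then show ?thesis
    by (simp add: ext_deriv_def fun_eq_iff)
qed

lemma zero_in_forms:
  assumes "open U"
  shows "0 \<in> forms U p"
proof -
  have "alternating p (\<lambda>v. 0)"
    by (auto simp: alternating_def linear_iff)
  then have "const_form U (\<lambda>v. 0) \<in> forms U p"
    by (rule const_form_in_forms[OF assms])
  moreover have "const_form U (\<lambda>v. 0) = 0"
    by (simp add: const_form_def fun_eq_iff)
  ultimately show ?thesis
    by metis
qed

lemma pullback_incl_in_forms_on_submanifold:
  assumes "open U" and "B \<subseteq> U" and "\<omega> \<in> forms U p"
  shows "pullback_incl B p \<omega> \<in> forms_on_submanifold B p"
  using assms unfolding forms_on_submanifold_def pullback_incl_def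
  by (fastforce simp: fun_eq_iff)

lemma cov_deriv_eq_iff:
  "cov_deriv U p A \<Phi> = J \<longleftrightarrow> wedge1 p A \<Phi> = J - ext_deriv U p \<Phi>"
  unfolding cov_deriv_def by (auto simp: fun_eq_iff algebra_simps)

text \<open>The wedge product of the \<open>p\<close> covectors dual to \<open>b 0\<close>, ...,
  \<open>b (p - 1)\<close> under the inner product. For \<open>p = 0\<close> the determinant is
  empty and the form is the constant 1.\<close>

definition det_form :: "nat \<Rightarrow> (nat \<Rightarrow> 'a::euclidean_space) \<Rightarrow> (nat \<Rightarrow> 'a) \<Rightarrow> real" where
  "det_form p b v = det (mat p p (\<lambda>(i, j). v i \<bullet> b j))"

text \<open>Laplace expansion along row \<open>i\<close>: its cofactors do not involve that row, so
  they can be written with the unmodified \<open>v\<close>. Linearity in the slot can then be read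
  off.\<close>

lemma det_form_expand_slot:
  assumes "i < p"
  shows "det_form p b (v(i := a)) =
    (\<Sum>j<p. (a \<bullet> b j) * cofactor (mat p p (\<lambda>(i, j). v i \<bullet> b j)) i j)"
proof -
  let ?M = "mat p p (\<lambda>(k, j). (v(i := a)) k \<bullet> b j)"
  have "mat_delete ?M i j = mat_delete (mat p p (\<lambda>(i, j). v i \<bullet> b j)) i j" if "j < p" for j
    using assms that by (intro eq_matI) (auto simp: mat_delete_def)
  then have "cofactor ?M i j = cofactor (mat p p (\<lambda>(i, j). v i \<bullet> b j)) i j" if "j < p" for j
    using that by (simp add: cofactor_def)
  moreover have "det ?M = (\<Sum>j<p. ?M $$ (i, j) * cofactor ?M i j)"
    by (rule laplace_expansion_row) (use assms in auto)
  ultimately show ?thesis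
    using assms by (simp add: det_form_def)
qed

lemma alternating_det_form: "alternating p (det_form p b)"
  unfolding alternating_def
proof (intro conjI allI impI)
  fix v w :: "nat \<Rightarrow> 'a"
  assume "\<forall>i<p. v i = w i"
  then show "det_form p b v = det_form p b w"
    unfolding det_form_def by (intro arg_cong[where f = det] eq_matI) auto
next
  fix v :: "nat \<Rightarrow> 'a" and i
  assume "i < p"
  then show "linear (\<lambda>a. det_form p b (v(i := a)))"
    by (simp add: det_form_expand_slot linear_iff inner_add_left distrib_right sum.distrib
        sum_distrib_left mult.assoc)
next
  fix v :: "nat \<Rightarrow> 'a" and i j
  assume "i < p" "j < p" "i \<noteq> j \<and> v i = v j"
  then show "det_form p b v = 0"
    unfolding det_form_def
    by (intro det_identical_rows[of _ p i j] eq_vecI) auto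
qed

text \<open>This is the vanishing of the wedge of a covector with a product that already contains
  it: the sum is the expansion along the first column of a determinant with a repeated
  column.\<close>

lemma sum_omit_det_form:
  assumes "0 < p"
  shows "(\<Sum>i\<le>p. (-1) ^ i * (v i \<bullet> b 0) * det_form p b (omit i v)) = 0"
proof -
  \<comment> \<open>Truncated subtraction makes columns 0 and 1 both pair with \<open>b 0\<close>;
    column 1 exists since \<open>0 < p\<close>.\<close>
  define M where "M = mat (Suc p) (Suc p) (\<lambda>(i, j). v i \<bullet> b (j - 1))"
  have M: "M \<in> carrier_mat (Suc p) (Suc p)"
    by (simp add: M_def)
  have "mat_delete M i 0 = mat p p (\<lambda>(k, j). omit i v k \<bullet> b j)" if "i \<le> p" for i
    using that by (intro eq_matI) (auto simp: mat_delete_def M_def omit_def)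
  then have "cofactor M i 0 = (-1) ^ i * det_form p b (omit i v)" if "i \<le> p" for i
    using that by (simp add: cofactor_def det_form_def)
  moreover have "det M = (\<Sum>i<Suc p. M $$ (i, 0) * cofactor M i 0)"
    by (rule laplace_expansion_column[OF M]) simp
  moreover have "det M = 0"
    by (rule det_identical_columns[OF M, of 0 1])
      (use assms in \<open>auto simp: M_def intro!: eq_vecI\<close>)
  ultimately show ?thesis
    by (simp add: M_def lessThan_Suc_atMost mult_ac)
qed

text \<open>The Gram matrix of an orthonormal family is the identity. This shows that the example
  field is nonzero.\<close>

lemma det_form_orthonormal:
  assumes "\<And>i j. i < p \<Longrightarrow> j < p \<Longrightarrow> b i \<bullet> b j = (if i = j then 1 else 0)"
  shows "det_form p b b = 1"
proof -
  have "mat p p (\<lambda>(i, j). b i \<bullet> b j) = 1\<^sub>m p"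
    using assms by (intro eq_matI) auto
  then show ?thesis
    by (simp add: det_form_def)
qed

lemma alternating_scaleR_right:
  fixes f :: "(nat \<Rightarrow> 'a::real_vector) \<Rightarrow> real" and c :: "'b::real_vector"
  assumes "alternating p f"
  shows "alternating p (\<lambda>v. f v *\<^sub>R c)"
proof -
  have "linear (\<lambda>a. g a *\<^sub>R c)" if "linear g" for g :: "'a \<Rightarrow> real"
    using that by (simp add: linear_iff scaleR_left_distrib)
  with assms show ?thesis
    unfolding alternating_def by auto
qed

lemma alternating_one_inner: "alternating (1::nat) (\<lambda>v. v 0 \<bullet> b)"
  by (auto simp: alternating_def linear_iff inner_add_left)

text \<open>The hypothesis is a scalar times a vector, so that it covers both sources of
  non-uniqueness: the scalar sum vanishes, or \<open>T\<close> annihilates \<open>e\<close>.\<close>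

lemma wedge1_const_form:
  assumes "\<And>v. (\<Sum>i\<le>p. (-1) ^ i * (v i \<bullet> \<beta>) * f (omit i v)) *\<^sub>R blinfun_apply T e = 0"
  shows "wedge1 p (const_form U (\<lambda>v. (v 0 \<bullet> \<beta>) *\<^sub>R T)) (const_form U (\<lambda>v. f v *\<^sub>R e)) = 0"
proof (intro ext)
  fix x v
  show "wedge1 p (const_form U (\<lambda>v. (v 0 \<bullet> \<beta>) *\<^sub>R T)) (const_form U (\<lambda>v. f v *\<^sub>R e)) x v = 0 x v"
    using assms[of v]
    by (cases "x \<in> U") (simp_all add: wedge1_def const_form_def blinfun.scaleR_left
        blinfun.scaleR_right scaleR_sum_left mult_ac)
qed

lemma wedge1_zero_left: "wedge1 p 0 \<Phi> = 0"
  by (simp add: wedge1_def fun_eq_iff)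

text \<open>The two connections are 0 and \<open>A'\<close>, both with current 0. The proposition
  \<open>P\<close> stands for the condition under which the field must vanish nowhere.\<close>

lemma nonunique_connection:
  fixes U :: "'a::euclidean_space set" and f :: "(nat \<Rightarrow> 'a) \<Rightarrow> real"
    and e :: "'v::euclidean_space" and T :: "'v \<Rightarrow>\<^sub>L 'v"
  assumes "open U" and "x\<^sub>0 \<in> U" and "B \<subseteq> U" and "alternating p f"
    and "\<beta> \<noteq> 0" and "T \<noteq> 0"
    and "\<And>v. (\<Sum>i\<le>p. (-1) ^ i * (v i \<bullet> \<beta>) * f (omit i v)) *\<^sub>R blinfun_apply T e = 0"
    and "P \<Longrightarrow> \<exists>v. f v *\<^sub>R e \<noteq> 0"
  shows "\<exists>J \<in> forms U (p + 1). \<exists>\<Phi> \<in> forms U p. \<exists>\<alpha> \<in> forms_on_submanifold B p.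
    pullback_incl B p \<Phi> = \<alpha> \<and> (P \<longrightarrow> (\<forall>x\<in>U. \<Phi> x \<noteq> 0)) \<and>
    (\<exists>A A' :: ('a, 'v \<Rightarrow>\<^sub>L 'v) form. A \<in> forms U 1 \<and> A' \<in> forms U 1 \<and> A \<noteq> A' \<and>
       cov_deriv U p A \<Phi> = J \<and> cov_deriv U p A' \<Phi> = J)"
proof -
  define \<Phi> where "\<Phi> = const_form U (\<lambda>v. f v *\<^sub>R e)"
  define A' where "A' = const_form U (\<lambda>v. (v 0 \<bullet> \<beta>) *\<^sub>R T)"
  have \<Phi>: "\<Phi> \<in> forms U p"
    unfolding \<Phi>_def by (intro const_form_in_forms alternating_scaleR_right assms)
  have A': "A' \<in> forms U 1"
    unfolding A'_def
    by (intro const_form_in_forms alternating_scaleR_right alternating_one_inner assms)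
  \<comment> \<open>The value is \<beta> \<bullet> \<beta> times \<open>T\<close>, and both factors
    are nonzero.\<close>
  have "A' x\<^sub>0 (\<lambda>_. \<beta>) \<noteq> 0"
    using assms(2,5,6) by (simp add: A'_def const_form_def)
  then have "0 \<noteq> A'"
    by auto
  moreover have "cov_deriv U p 0 \<Phi> = 0" "cov_deriv U p A' \<Phi> = 0"
    unfolding cov_deriv_def \<Phi>_def A'_def
    by (simp_all add: wedge1_zero_left wedge1_const_form assms ext_deriv_const_form)
  moreover have "P \<longrightarrow> (\<forall>x\<in>U. \<Phi> x \<noteq> 0)"
    using assms(8) by (auto simp: \<Phi>_def const_form_def fun_eq_iff)
  ultimately show ?thesis
    using \<Phi> A' zero_in_forms[OF assms(1), of 1, where 'b = "'v \<Rightarrow>\<^sub>L 'v"]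
      zero_in_forms[OF assms(1), of "p + 1", where 'b = 'v]
      pullback_incl_in_forms_on_submanifold[OF assms(1,3) \<Phi>]
    by blast
qed

theorem theorem5:
  fixes U B :: "(real ^ 'n) set" and x\<^sub>0 :: "real ^ 'n" and p :: nat
  assumes "open U" and "x\<^sub>0 \<in> U" and "\<forall>x\<in>U. closed_segment x\<^sub>0 x \<subseteq> U"
    and "B \<subseteq> U" and "regular_convex_hypersurface B"
  shows "(\<forall>J \<in> forms U (p + 1). \<forall>\<Phi> \<in> forms U p. \<forall>\<alpha> \<in> forms_on_submanifold B p.
            pullback_incl B p \<Phi> = \<alpha> \<longrightarrow>
            (\<forall>A :: (real ^ 'n, 'v \<Rightarrow>\<^sub>L 'v::euclidean_space) form. A \<in> forms U 1 \<longrightarrow>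
               (cov_deriv U p A \<Phi> = J \<longleftrightarrow> wedge1 p A \<Phi> = J - ext_deriv U p \<Phi>)))
       \<and> (\<exists>J \<in> forms U (p + 1). \<exists>\<Phi> \<in> forms U p. \<exists>\<alpha> \<in> forms_on_submanifold B p.
            pullback_incl B p \<Phi> = \<alpha> \<and>
            (p \<le> CARD('n) \<and> (1 \<le> p \<or> 2 \<le> DIM('v)) \<longrightarrow> (\<forall>x\<in>U. \<Phi> x \<noteq> 0)) \<and>
            (\<exists>A A' :: (real ^ 'n, 'v \<Rightarrow>\<^sub>L 'v) form. A \<in> forms U 1 \<and> A' \<in> forms U 1 \<and> A \<noteq> A' \<and>
               cov_deriv U p A \<Phi> = J \<and> cov_deriv U p A' \<Phi> = J))"
    (is "?algebraic \<and> ?nonunique")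
proof
  show ?algebraic
    by (simp add: cov_deriv_eq_iff)
next
  \<comment> \<open>Outside \<open>?P\<close> no nowhere vanishing example exists: for
    \<open>p\<close> above the dimension all \<open>p\<close>-forms are 0, and for
    \<open>p = 0\<close> with \<open>V\<close> a line such a field determines
    \<open>A\<close>.\<close>
  let ?P = "p \<le> CARD('n) \<and> (1 \<le> p \<or> 2 \<le> DIM('v))"
  obtain b where b: "bij_betw b {0..<DIM(real ^ 'n)} (Basis :: (real ^ 'n) set)"
    using ex_bij_betw_nat_finite[OF finite_Basis] by blast
  have in_Basis: "b i \<in> Basis" if "i < CARD('n)" for i
    using bij_betwE[OF b] that by simp
  have "b i \<bullet> b j = (if i = j then 1 else 0)" if "i < CARD('n)" "j < CARD('n)" for i j
    using that in_Basis[of i] in_Basis[of j] bij_betw_imp_inj_on[OF b]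
    by (auto simp: inner_Basis inj_on_def)
  then have det_b: "det_form p b b = 1" if "p \<le> CARD('n)"
    using that by (intro det_form_orthonormal) auto
  have b0: "b 0 \<noteq> 0"
    using in_Basis[of 0] by (simp add: nonzero_Basis)
  obtain e :: 'v where e: "e \<in> Basis"
    by (meson SOME_Basis)
  have "\<exists>(c :: 'v) (T :: 'v \<Rightarrow>\<^sub>L 'v). T \<noteq> 0 \<and> (?P \<longrightarrow> c \<noteq> 0) \<and>
    (\<forall>v. (\<Sum>i\<le>p. (-1) ^ i * (v i \<bullet> b 0) * det_form p b (omit i v)) *\<^sub>R blinfun_apply T c = 0)"
  proof -
    have id: "(id_blinfun :: 'v \<Rightarrow>\<^sub>L 'v) \<noteq> 0"
      using e by (metis blinfun.zero_left blinfun_apply_id_blinfun id_apply nonzero_Basis)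
    consider "1 \<le> p" | "p = 0" "2 \<le> DIM('v)" | "\<not> ?P"
      by linarith
    then show ?thesis
    proof cases
      case 1
      with id e show ?thesis
        by (intro exI[of _ e] exI[of _ id_blinfun]) (simp add: sum_omit_det_form nonzero_Basis)
    next
      case 2
      then have "\<not> (Basis :: 'v set) \<subseteq> {e}"
        using card_mono[of "{e}" "Basis :: 'v set"] by auto
      then obtain e' :: 'v where e': "e' \<in> Basis" "e' \<noteq> e"
        by blast
      \<comment> \<open>The orthogonal projection onto the line of \<open>e'\<close>: it kills
        \<open>e\<close> but fixes \<open>e'\<close>.\<close>
      then have "blinfun_apply (blinfun_scaleR_left e' o\<^sub>L blinfun_inner_left e') e' \<noteq> 0"
        by (simp add: nonzero_Basis)
      then have "blinfun_scaleR_left e' o\<^sub>L blinfun_inner_left e' \<noteq> 0"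
        by (metis blinfun.zero_left)
      with e e' show ?thesis
        by (intro exI[of _ e] exI[of _ "blinfun_scaleR_left e' o\<^sub>L blinfun_inner_left e'"])
          (simp add: inner_Basis nonzero_Basis)
    \<comment> \<open>In the remaining case the field is 0, and every connection solves the equation
      with current 0.\<close>
    next
      case 3
      with id show ?thesis
        by (intro exI[of _ 0] exI[of _ id_blinfun]) auto
    qed
  qed
  then obtain c :: 'v and T :: "'v \<Rightarrow>\<^sub>L 'v" where "T \<noteq> 0" "?P \<longrightarrow> c \<noteq> 0"
    "\<And>v. (\<Sum>i\<le>p. (-1) ^ i * (v i \<bullet> b 0) * det_form p b (omit i v)) *\<^sub>R blinfun_apply T c = 0"
    by blast
  \<comment> \<open>The field is nonzero at each point of \<open>U\<close> because its value on the
    tuple \<open>b\<close> is \<open>c\<close>.\<close>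
  then show ?nonunique
    using det_b
    by (intro nonunique_connection[OF assms(1,2,4) alternating_det_form b0, of T p b c])
      (auto intro!: exI[of _ b])
qed

end
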